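(* Let $P=\{p_1,p_2,\dots,p_n\}$ be a finite commutative pseudoquandle such that $\ker(p_1)\subseteq\ker(p_2)\subseteq\cdots\subseteq\ker(p_n)$. Then $$|P|=|\ker(p_1)|+\sum_{k=1}^{n-1}|\mathrm{coker}(p_k:p_{k+1})|.$$
   Context: A commutative pseudoquandle is a set $P$ with a commutative binary operation $\ast$ such that $q\ast q=q$ for all $q\in P$ and $(p\ast q)\ast r=(p\ast r)\ast(q\ast r)$ for all $p,q,r\in P$. For $p\in P$, the kernel of $p$ is $\ker(p)=\{q\in P\mid p\ast q=q\ast p=p\}$. For $p,q\in P$ with $q\in\ker(p)$, the relative cokernel of $q$ in $p$ is $\mathrm{coker}(q:p)=\ker(p)-\ker(q)=\{s\in\ker(p)\mid s\ast q\neq q\}$; if $q\notin\ker(p)$, then $\mathrm{coker}(q:p)=\emptyset$. *)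

theory Defs
  imports Main
begin

locale commutative_pseudoquandle =
  fixes P :: "'a set"
    and op :: "'a \<Rightarrow> 'a \<Rightarrow> 'a"  (infixl \<open>\<star>\<close> 70)
  assumes closed: "p \<in> P \<Longrightarrow> q \<in> P \<Longrightarrow> p \<star> q \<in> P"
    and commute: "p \<in> P \<Longrightarrow> q \<in> P \<Longrightarrow> p \<star> q = q \<star> p"
    and idem: "q \<in> P \<Longrightarrow> q \<star> q = q"
    and self_distrib:
      "p \<in> P \<Longrightarrow> q \<in> P \<Longrightarrow> r \<in> P \<Longrightarrow> (p \<star> q) \<star> r = (p \<star> r) \<star> (q \<star> r)"

definition ker :: "'a set \<Rightarrow> ('a \<Rightarrow> 'a \<Rightarrow> 'a) \<Rightarrow> 'a \<Rightarrow> 'a set" where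
  "ker P op p = {q \<in> P. op p q = p \<and> op q p = p}"

(* "coker P op q p" is the relative cokernel coker(q : p) of q in p. *)
definition coker :: "'a set \<Rightarrow> ('a \<Rightarrow> 'a \<Rightarrow> 'a) \<Rightarrow> 'a \<Rightarrow> 'a \<Rightarrow> 'a set" where
  "coker P op q p = (if q \<in> ker P op p then ker P op p - ker P op q else {})"

lemma (in commutative_pseudoquandle) coker_eq:
  assumes "p \<in> P" "q \<in> ker P (\<star>) p"
  shows "coker P (\<star>) q p = {s \<in> ker P (\<star>) p. s \<star> q \<noteq> q}"
  using assms commute by (auto simp: coker_def ker_def)

end

theory Submission
  imports Defs
begin

context commutative_pseudoquandle
begin

text \<open>By idempotence every element lies in its own kernel. Along the chain, each
  \<open>p k\<close> therefore lies in the largest kernel, that of \<open>p n\<close>, which must be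
  all of \<open>P\<close> (\<open>image_subset_ker_last\<close>). It remains to measure the last
  kernel by telescoping: each inclusion adds exactly the relative cokernel to the previous kernel
  (\<open>card_ker_chain\<close>).\<close>

lemma self_in_ker: "p \<in> P \<Longrightarrow> p \<in> ker P (\<star>) p"
  by (simp add: ker_def idem)

text \<open>Since \<open>q\<close> is in its own kernel, the inclusion puts it in the kernel of
  \<open>p\<close>. So \<open>coker\<close> is the genuine set difference, not the default
  \<open>{}\<close>, and the larger kernel splits disjointly.\<close>

lemma card_ker_eq_card_ker_plus_card_coker:
  assumes "finite P" "q \<in> P" "ker P (\<star>) q \<subseteq> ker P (\<star>) p"
  shows "card (ker P (\<star>) p) = card (ker P (\<star>) q) + card (coker P (\<star>) q p)"
proof -
  have "finite (ker P (\<star>) p)"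
    using assms(1) by (simp add: ker_def)
  moreover have "coker P (\<star>) q p = ker P (\<star>) p - ker P (\<star>) q"
    using self_in_ker assms(2,3) by (auto simp: coker_def)
  ultimately show ?thesis
    using assms(3) by (simp add: card_Diff_subset card_mono finite_subset)
qed

lemma card_ker_chain:
  fixes p :: "nat \<Rightarrow> 'a"
  assumes "finite P" "\<And>k. 1 \<le> k \<Longrightarrow> k \<le> m \<Longrightarrow> p k \<in> P" "1 \<le> m"
    and "\<And>k. 1 \<le> k \<Longrightarrow> k < m \<Longrightarrow> ker P (\<star>) (p k) \<subseteq> ker P (\<star>) (p (k + 1))"
  shows "card (ker P (\<star>) (p m)) =
    card (ker P (\<star>) (p 1)) + (\<Sum>k = 1..m - 1. card (coker P (\<star>) (p k) (p (k + 1))))"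
  using assms(3,2,4)
proof (induction m rule: dec_induct)
  case base
  then show ?case by simp
next
  case (step m)
  have "card (ker P (\<star>) (p (m + 1))) =
      card (ker P (\<star>) (p m)) + card (coker P (\<star>) (p m) (p (m + 1)))"
    using step.hyps step.prems by (intro card_ker_eq_card_ker_plus_card_coker assms(1)) auto
  \<comment> \<open>Splits off the new top summand; for \<open>m = 1\<close> the remaining range
    \<open>{1..0}\<close> is empty.\<close>
  moreover have "{1..m} = insert m {1..m - 1}"
    using step.hyps by auto
  ultimately show ?case
    using step by simp
qed

text \<open>Each \<open>p k\<close> starts in its own kernel and is carried upward by the later
  inclusions.\<close>

lemma image_subset_ker_last:
  fixes p :: "nat \<Rightarrow> 'a"
  assumes "\<And>k. 1 \<le> k \<Longrightarrow> k \<le> m \<Longrightarrow> p k \<in> P" "1 \<le> m"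
    and "\<And>k. 1 \<le> k \<Longrightarrow> k < m \<Longrightarrow> ker P (\<star>) (p k) \<subseteq> ker P (\<star>) (p (k + 1))"
  shows "p ` {1..m} \<subseteq> ker P (\<star>) (p m)"
  using assms(2,1,3)
proof (induction m rule: dec_induct)
  case base
  then show ?case by (simp add: self_in_ker)
next
  case (step m)
  then have "p ` {1..m} \<subseteq> ker P (\<star>) (p (m + 1))"
    by (meson le_SucI less_SucI lessI order_trans)
  then show ?case
    using step.prems(1)[of "Suc m"] by (simp add: atLeastAtMostSuc_conv self_in_ker)
qed

end

theorem theorem3p14:
  fixes P :: "'a set"
    and op :: "'a \<Rightarrow> 'a \<Rightarrow> 'a"
    and p :: "nat \<Rightarrow> 'a"
    and n :: nat
  assumes "commutative_pseudoquandle P op"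
    and "finite P"
    and "n \<ge> 1"
    and "bij_betw p {1..n} P"
    and "\<And>k. 1 \<le> k \<Longrightarrow> k < n \<Longrightarrow> ker P op (p k) \<subseteq> ker P op (p (k + 1))"
  shows "card P = card (ker P op (p 1)) + (\<Sum>k = 1..n - 1. card (coker P op (p k) (p (k + 1))))"
proof -
  interpret commutative_pseudoquandle P op by fact
  have image: "p ` {1..n} = P"
    using assms(4) by (rule bij_betw_imp_surj_on)
  then have in_P: "p k \<in> P" if "1 \<le> k" "k \<le> n" for k
    using that by auto
  \<comment> \<open>The enumeration exhausts \<open>P\<close>, so the last kernel absorbs every
    element and its cardinality is that of \<open>P\<close>.\<close>
  have "P \<subseteq> ker P op (p n)"
    using image_subset_ker_last[of n p, OF in_P assms(3,5)] image by simp
  then have "ker P op (p n) = P"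
    by (auto simp: ker_def)
  then show ?thesis
    using card_ker_chain[of n p, OF assms(2) in_P assms(3,5)] by simp
qed

end
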